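(* For every integer $d \geq 2$ and all $k, m \in \mathbb{N}_{+}$, there is a strategy for Presenter in the on-line $(k,d)$ unit interval coloring game that forces Algorithm to use at least $\left\lfloor \frac{5m}{2} \right\rfloor \frac{d}{\log d + 3}$ different colors while the constructed set of intervals is $m\left(\frac{d}{k} + \log d + 3\right)$-colorable. Here $\log$ denotes the logarithm to base $2$.
   Context: Intervals are closed intervals $[l,r]$ on the real line; the length of $[l,r]$ is $r-l$. Each interval carries a $d$-dimensional vector of weights from $[0,1]^d$. Intervals are treated as individual objects: several presented intervals may have the same endpoints. A $(k,d)$-coloring of a finite collection of weighted intervals is an assignment of colors to the intervals such that for each color $\gamma$ and each point $p$ of the real line: the number of intervals containing $p$ and colored $\gamma$ does not exceed $k$, and the sum of the weight vectors of the intervals containing $p$ and colored $\gamma$ does not exceed $1$ in any of the $d$ coordinates. For a real number $x$, a finite collection of weighted intervals is $x$-colorable if it has a $(k,d)$-coloring using at most $x$ colors. The on-line $(k,d)$ unit interval coloring game is played by Presenter and Algorithm. In each round Presenter introduces a new interval of length exactly $1$ with a $d$-dimensional vector of weights from $[0,1]$. Algorithm irrevocably assigns a color to it, before the next interval is introduced, so that the coloring of all intervals presented so far is a $(k,d)$-coloring. Algorithm may use any number of colors and aims to minimize the number of different colors used. Presenter presents finitely many intervals and then the game ends. A strategy for Presenter "forces Algorithm to use at least $c$ colors while the constructed set of intervals is $x$-colorable" if, whatever valid choices Algorithm makes, at the end of the game played against this strategy Algorithm has used at least $c$ different colors and the collection of all presented weighted intervals is $x$-colorable. *)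

theory Defs
  imports Complex_Main
begin

text \<open>Only the coordinates \<open>j < d\<close> of the weight function are meaningful. A finite collection
  of weighted intervals is a list (in order of presentation), so intervals with equal data remain
  distinct objects; a coloring is the list of colors at the corresponding positions.\<close>

datatype winterval = WInterval (lend: real) (rend: real) (weight: "nat \<Rightarrow> real")

definition points :: "winterval \<Rightarrow> real set" where
  "points J = {lend J..rend J}"

definition unit_weighted :: "nat \<Rightarrow> winterval \<Rightarrow> bool" where
  "unit_weighted d J \<longleftrightarrow> rend J - lend J = 1 \<and> (\<forall>j<d. 0 \<le> weight J j \<and> weight J j \<le> 1)"

definition class_at :: "winterval list \<Rightarrow> nat list \<Rightarrow> nat \<Rightarrow> real \<Rightarrow> nat set" where
  "class_at Js cs \<gamma> p = {i. i < length Js \<and> cs ! i = \<gamma> \<and> p \<in> points (Js ! i)}"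

definition kd_coloring :: "nat \<Rightarrow> nat \<Rightarrow> winterval list \<Rightarrow> nat list \<Rightarrow> bool" where
  "kd_coloring k d Js cs \<longleftrightarrow> length cs = length Js \<and>
     (\<forall>\<gamma> p. card (class_at Js cs \<gamma> p) \<le> k \<and>
            (\<forall>j<d. (\<Sum>i\<in>class_at Js cs \<gamma> p. weight (Js ! i) j) \<le> 1))"

definition colorable :: "nat \<Rightarrow> nat \<Rightarrow> real \<Rightarrow> winterval list \<Rightarrow> bool" where
  "colorable k d x Js \<longleftrightarrow> (\<exists>cs. kd_coloring k d Js cs \<and> real (card (set cs)) \<le> x)"

text \<open>A history lists the presented intervals with Algorithm's colors, oldest first. A Presenter
  strategy maps the history to the next interval, or to \<open>None\<close> to end the game.\<close>

type_synonym history = "(winterval \<times> nat) list"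
type_synonym strategy = "history \<Rightarrow> winterval option"

text \<open>The positions reachable against \<open>S\<close> under arbitrary valid choices of Algorithm.\<close>

inductive play :: "nat \<Rightarrow> nat \<Rightarrow> strategy \<Rightarrow> history \<Rightarrow> bool" for k d S where
  start: "play k d S []"
| round: "\<lbrakk>play k d S h; S h = Some J;
           kd_coloring k d (map fst h @ [J]) (map snd h @ [c])\<rbrakk>
          \<Longrightarrow> play k d S (h @ [(J, c)])"

text \<open>Besides presenting only admissible intervals, Presenter must end every play after finitely
  many rounds: there is no infinite sequence all of whose prefixes are plays.\<close>

definition presenter_strategy :: "nat \<Rightarrow> nat \<Rightarrow> strategy \<Rightarrow> bool" where
  "presenter_strategy k d S \<longleftrightarrow>
     (\<forall>h J. play k d S h \<longrightarrow> S h = Some J \<longrightarrow> unit_weighted d J) \<and>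
     \<not> (\<exists>f :: nat \<Rightarrow> winterval \<times> nat. \<forall>n. play k d S (map f [0..<n]))"

definition forces :: "nat \<Rightarrow> nat \<Rightarrow> strategy \<Rightarrow> real \<Rightarrow> real \<Rightarrow> bool" where
  "forces k d S c x \<longleftrightarrow>
     (\<forall>h. play k d S h \<longrightarrow> S h = None \<longrightarrow>
        c \<le> real (card (set (map snd h))) \<and> colorable k d x (map fst h))"

end

theory Submission
  imports Defs
begin

text \<open>Presenter plays stages of \<open>d\<close> intervals, the \<open>j\<close>-th interval of a stage having almost full
  weight in coordinate \<open>j\<close>. Small weights in the earlier coordinates decide with which earlier
  intervals of the stage it conflicts, so a stage encodes an arbitrary on-line graph, here that of
  Halldorsson and Szegedy: each interval gets one of \<open>2 * q\<close> hues, intervals of equal hue are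
  compatible, and yet each of Algorithm's colors occurs at most \<open>q\<close> times in a stage. The weights
  of different stages live on different scales, so that intersecting intervals of different stages
  always conflict.

  Let \<open>p = m div 2\<close>. Presenter plays a block \<open>A\<close> of \<open>p\<close> stages, then, to its right, a block
  \<open>B1\<close> of \<open>p\<close> stages in which the intervals whose colors do not occur in \<open>A\<close> start left of the
  other ones. If \<open>B1\<close> shows too few new colors, then a similar block \<open>B2\<close>, left of \<open>B1\<close>, must
  show many, because \<open>B1\<close> and \<open>B2\<close> intersect. A final block \<open>C\<close> of \<open>m - p\<close> stages meets \<open>A\<close>
  and exactly the intervals with new colors of the successful block, so that it needs yet other
  colors.\<close>

section \<open>Strategies from an invariant of plays of bounded length\<close>

text \<open>\<open>S\<close> chooses an interval that keeps \<open>Inv\<close> under every valid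
  reply and stops at length \<open>N\<close>. The fixed number of rounds rules out infinite
  plays.\<close>

lemma play_from_invariant:
  assumes start: "Inv []"
    and step: "\<And>h. Inv h \<Longrightarrow> length h < N \<Longrightarrow> \<exists>J. unit_weighted d J \<and>
      (\<forall>c. kd_coloring k d (map fst h @ [J]) (map snd h @ [c]) \<longrightarrow> Inv (h @ [(J, c)]))"
  shows "\<exists>S. presenter_strategy k d S \<and>
    (\<forall>h. play k d S h \<longrightarrow> S h = None \<longrightarrow> Inv h \<and> length h = N)"
proof -
  define good where "good h J \<longleftrightarrow> unit_weighted d J \<and>
      (\<forall>c. kd_coloring k d (map fst h @ [J]) (map snd h @ [c]) \<longrightarrow> Inv (h @ [(J, c)]))" for h J
  define S where "S h = (if length h < N then Some (SOME J. good h J) else None)" for h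
  have good: "good h (SOME J. good h J)" if "Inv h" "length h < N" for h
    using step[OF that] unfolding good_def by (rule someI_ex)
  have inv: "Inv h \<and> length h \<le> N" if "play k d S h" for h
    using that
  proof induction
    case start
    then show ?case using assms(1) by simp
  next
    case (round h J c)
    then show ?case using good[of h] by (auto simp: S_def good_def split: if_splits)
  qed
  have "\<not> (\<forall>n. play k d S (map f [0..<n]))" for f
    using inv[of "map f [0..<Suc N]"] by (metis Suc_n_not_le_n diff_zero length_map length_upt)
  moreover have "unit_weighted d J" if "play k d S h" "S h = Some J" for h J
    using that inv[of h] good[of h] by (auto simp: S_def good_def split: if_splits)
  ultimately have "presenter_strategy k d S"
    by (auto simp: presenter_strategy_def)
  moreover have "Inv h \<and> length h = N" if "play k d S h" "S h = None" for h
    using that inv[of h] by (auto simp: S_def split: if_splits)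
  ultimately show ?thesis by blast
qed

section \<open>Conflicting weights, and groups of equal hue\<close>

lemma finite_class_at: "finite (class_at Js cs \<gamma> x)"
  by (rule finite_subset[of _ "{..<length Js}"]) (auto simp: class_at_def)

text \<open>Weights are nonnegative, so the two intervals alone would overload coordinate
  \<open>j\<close> at \<open>x\<close>.\<close>

lemma conflicting_colors_distinct:
  assumes col: "kd_coloring k d Js cs" and unit: "\<And>J. J \<in> set Js \<Longrightarrow> unit_weighted d J"
    and st: "s < length Js" "t < length Js" "s \<noteq> t"
    and meet: "x \<in> points (Js ! s)" "x \<in> points (Js ! t)"
    and j: "j < d" "weight (Js ! s) j + weight (Js ! t) j > 1"
  shows "cs ! s \<noteq> cs ! t"
proof
  assume eq: "cs ! s = cs ! t"
  define X where "X = class_at Js cs (cs ! s) x"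
  have "{s, t} \<subseteq> X" using st meet eq by (auto simp: X_def class_at_def)
  moreover have "weight (Js ! i) j \<ge> 0" if "i \<in> X" for i
    using that unit[of "Js ! i"] j by (auto simp: X_def class_at_def unit_weighted_def)
  ultimately have "(\<Sum>i\<in>{s,t}. weight (Js ! i) j) \<le> (\<Sum>i\<in>X. weight (Js ! i) j)"
    by (intro sum_mono2) (auto simp: X_def finite_class_at)
  also have "\<dots> \<le> 1" using col j by (auto simp: X_def kd_coloring_def)
  finally show False using st j by simp
qed

text \<open>Each hue class is cut into runs of \<open>k\<close> by rank. Only the last run of a
  class can be incomplete, so a class of size \<open>n\<close> needs at most
  \<open>n / k + 1\<close> runs, and hypothesis \<open>Q\<close> bounds their total by
  \<open>Q\<close>.\<close>

lemma split_into_groups: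
  fixes S :: "nat set" and hue :: "nat \<Rightarrow> nat"
  assumes fin: "finite S" and hue: "hue ` S \<subseteq> {..<K}" and k: "k \<ge> 1"
    and Q: "card S + k * K < k * Suc Q"
  obtains f where "f ` S \<subseteq> {..<Q}"
    "\<And>s t. s \<in> S \<Longrightarrow> t \<in> S \<Longrightarrow> f s = f t \<Longrightarrow> hue s = hue t"
    "\<And>v. card {s \<in> S. f s = v} \<le> k"
proof -
  define rank where "rank s = card {t \<in> S. t < s \<and> hue t = hue s}" for s
  define g where "g s = (hue s, rank s div k)" for s
  define cls where "cls h = {s \<in> S. hue s = h}" for h
  \<comment> \<open>This is \<open>card (cls h) / k\<close> rounded up.\<close>
  define size where "size h = (card (cls h) + k - 1) div k" for h
  have fin_cls: "finite (cls h)" for h using fin by (simp add: cls_def)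
  have rank_less: "rank s < rank t" if "s \<in> S" "t \<in> S" "hue s = hue t" "s < t" for s t
    unfolding rank_def using that fin by (intro psubset_card_mono) auto
  have rank_inj: "inj_on rank (cls h)" for h
  proof (rule inj_onI)
    fix s t assume "s \<in> cls h" "t \<in> cls h" "rank s = rank t"
    then have "\<not> s < t" "\<not> t < s"
      using rank_less[of s t] rank_less[of t s] unfolding cls_def by auto
    then show "s = t" by simp
  qed
  have rank_bound: "rank s < card (cls (hue s))" if "s \<in> S" for s
    unfolding rank_def using that fin_cls by (intro psubset_card_mono) (auto simp: cls_def)
  have "g ` S \<subseteq> (SIGMA h:{..<K}. {..<size h})"
  proof (clarsimp simp: g_def)
    fix s assume s: "s \<in> S"
    have "rank s div k < size (hue s)"
    proof -
      have "rank s + k \<le> card (cls (hue s)) + k - 1" using rank_bound[OF s] by linarith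
      then have "(rank s + k) div k \<le> size (hue s)" unfolding size_def by (rule div_le_mono)
      then show ?thesis using k by simp
    qed
    then show "hue s < K \<and> rank s div k < size (hue s)" using hue s by auto
  qed
  then have "card (g ` S) \<le> card (SIGMA h:{..<K}. {..<size h})"
    by (intro card_mono) auto
  also have "\<dots> = (\<Sum>h<K. size h)" by simp
  finally have 1: "card (g ` S) \<le> (\<Sum>h<K. size h)" .
  have "k * (\<Sum>h<K. size h) = (\<Sum>h<K. k * size h)" by (simp add: sum_distrib_left)
  also have "\<dots> \<le> (\<Sum>h<K. card (cls h) + k)"
    by (rule sum_mono) (auto simp: size_def intro: order.trans[OF times_div_less_eq_dividend])
  also have "\<dots> = (\<Sum>h<K. card (cls h)) + k * K" by (simp add: sum.distrib)
  also have "(\<Sum>h<K. card (cls h)) = card (\<Union>h<K. cls h)"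
    using fin by (intro card_UN_disjoint[symmetric]) (auto simp: cls_def)
  also have "(\<Union>h<K. cls h) = S" using hue by (auto simp: cls_def)
  finally have "k * (\<Sum>h<K. size h) < k * Suc Q" using Q by linarith
  then have "(\<Sum>h<K. size h) \<le> Q" by (auto simp only: mult_less_cancel1 less_Suc_eq_le)
  with 1 have "card (g ` S) \<le> Q" by linarith
  \<comment> \<open>\<open>e\<close> numbers the occurring pairs of hue and run by values below
    \<open>Q\<close>.\<close>
  then obtain e where e: "inj_on e (g ` S)" "e ` g ` S \<subseteq> {..<Q}"
    using card_le_inj[of "g ` S" "{..<Q}"] fin by auto
  show thesis
  proof (rule that[of "e \<circ> g"])
    show "(e \<circ> g) ` S \<subseteq> {..<Q}" using e by auto
    have eg: "(e \<circ> g) s = (e \<circ> g) t \<longleftrightarrow> g s = g t" if "s \<in> S" "t \<in> S" for s t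
      using that e by (auto simp: inj_on_def)
    show "hue s = hue t" if "s \<in> S" "t \<in> S" "(e \<circ> g) s = (e \<circ> g) t" for s t
      using that eg[of s t] by (simp add: g_def)
    show "card {s \<in> S. (e \<circ> g) s = v} \<le> k" for v
    proof (cases "{s \<in> S. (e \<circ> g) s = v} = {}")
      case False
      then obtain s where s: "s \<in> S" "(e \<circ> g) s = v" by auto
      then have "{t \<in> S. (e \<circ> g) t = v} = {t \<in> S. g t = g s}"
        using eg by (intro Collect_cong) auto
      \<comment> \<open>Ranks are injective within a hue, and only \<open>k\<close> ranks have a
        given quotient by \<open>k\<close>.\<close>
      moreover have "card \<dots> \<le> card {k * (rank s div k)..<k * (rank s div k) + k}"
      proof (rule card_inj_on_le[of rank])
        show "inj_on rank {t \<in> S. g t = g s}"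
          by (rule inj_on_subset[OF rank_inj[of "hue s"]]) (auto simp: g_def cls_def)
        have "rank t \<in> {k * (rank s div k)..<k * (rank s div k) + k}" if "g t = g s" for t
        proof -
          have "rank t div k = rank s div k" using that by (simp add: g_def)
          then have "k * (rank s div k) + rank t mod k = rank t" by (metis mult_div_mod_eq)
          moreover have "rank t mod k < k" using k by simp
          ultimately show ?thesis by simp
        qed
        then show "rank ` {t \<in> S. g t = g s} \<subseteq> {k * (rank s div k)..<k * (rank s div k) + k}"
          by blast
      qed simp
      ultimately show ?thesis by simp
    next
      case True
      then show ?thesis by (simp only: card.empty)
    qed
  qed
qed

section \<open>Positions that separate new from old colors\<close>

text \<open>A ternary expansion with digits 1 and -1. Its value on the replies so far, scaled and
  shifted, places the next interval: \<open>True\<close> sends later intervals to the right,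
  \<open>False\<close> to the left.\<close>

primrec sep :: "bool list \<Rightarrow> real" where
  "sep [] = 0"
| "sep (b # bs) = ((if b then 1 else - 1) + sep bs) / 3"

lemma abs_sep: "\<bar>sep bs\<bar> < 1 / 2"
  by (induction bs) (auto simp: abs_if split: if_splits)

lemma sep_append: "sep (us @ vs) = sep us + sep vs / 3 ^ length us"
  by (induction us) (auto simp: field_simps)

text \<open>Digit \<open>i\<close> contributes \<open>1 / 3 ^ Suc i\<close> in absolute value and
  all later digits together less than half of that, so digit \<open>i\<close> decides on which side
  of the prefix value the final value lies.\<close>

lemma sep_take_less:
  assumes "i < length bs"
  shows "bs ! i \<Longrightarrow> sep (take i bs) < sep bs" "\<not> bs ! i \<Longrightarrow> sep bs < sep (take i bs)"
proof -
  have "sep bs = sep (take i bs @ (bs ! i # drop (Suc i) bs))"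
    using assms by (simp add: id_take_nth_drop[symmetric])
  also have "\<dots> = sep (take i bs) + sep (bs ! i # drop (Suc i) bs) / 3 ^ i"
    using assms by (simp add: sep_append del: sep.simps)
  finally have eq: "sep bs = sep (take i bs) + sep (bs ! i # drop (Suc i) bs) / 3 ^ i" .
  have "\<bar>sep (drop (Suc i) bs)\<bar> < 1 / 2" by (rule abs_sep)
  then show "bs ! i \<Longrightarrow> sep (take i bs) < sep bs" "\<not> bs ! i \<Longrightarrow> sep bs < sep (take i bs)"
    unfolding eq by (auto simp: divide_neg_pos)
qed

section \<open>The number of hues\<close>

text \<open>With \<open>q\<close> the rounded-up value of \<open>x\<close>, \<open>4 ^ q\<close> is
  at least \<open>2 * d\<close>, and the bound \<open>4 ^ q / (2 * q)\<close> for the central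
  binomial coefficient gives the last claim. Rounding adds less than 1 to \<open>q\<close>, hence 3
  in place of 1.\<close>

lemma hue_count_exists:
  fixes d :: nat
  assumes "d \<ge> 2"
  obtains q where "q \<ge> 1" "2 * real q \<le> log 2 (real d) + 3" "d \<le> q * ((2 * q) choose q)"
proof -
  define x where "x = (log 2 (real d) + 1) / 2"
  define q where "q = nat \<lceil>x\<rceil>"
  have "log 2 (real d) > 0" using assms by simp
  then have x: "x > 0" by (simp add: x_def)
  then have q: "q \<ge> 1" unfolding q_def by linarith
  have qx: "real q \<ge> x" "real q < x + 1" using x by (auto simp: q_def) linarith+
  show thesis
  proof (rule that[OF q])
    show "2 * real q \<le> log 2 (real d) + 3" using qx(2) by (simp add: x_def field_simps)
    have "log 2 (real d) + 1 \<le> real (2 * q)" using qx by (simp add: x_def)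
    then have "2 powr (log 2 (real d) + 1) \<le> 2 powr (real (2 * q))" by simp
    then have "2 * real d \<le> 2 ^ (2 * q)" using assms
      by (simp add: powr_add powr_realpow mult.commute del: of_nat_mult)
    then have "2 * real d \<le> 4 ^ q" by (simp add: power_mult)
    also have "4 ^ q / (2 * real q) \<le> real (2 * q choose q)"
      using q by (intro central_binomial_lower_bound) auto
    then have "4 ^ q \<le> real (2 * q choose q) * (2 * real q)" using q by (simp add: field_simps)
    finally have "real d \<le> real (q * (2 * q choose q))" by (simp add: mult_ac)
    then show "d \<le> q * (2 * q choose q)" by linarith
  qed
qed

section \<open>The Halldorsson-Szegedy game within a stage\<close>

text \<open>\<open>T\<close> is the number of stages and \<open>pos\<close> prescribes the left
  endpoint of the next interval. Its last assumption makes the intervals of one stage meet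
  pairwise.\<close>

locale hue_game =
  fixes d q k T :: nat and pos :: "history \<Rightarrow> real"
  assumes d: "d \<ge> 2" and q: "q \<ge> 1" and dq: "d \<le> q * ((2 * q) choose q)"
    and pos_close: "\<And>h s t. s \<le> length h \<Longrightarrow> t \<le> length h \<Longrightarrow> s div d = t div d \<Longrightarrow>
      \<bar>pos (take s h) - pos (take t h)\<bar> \<le> 1"
begin

text \<open>The factor \<open>2 * d\<close> leaves room for \<open>low s\<close>, which exceeds the scale of every earlier stage but
  is small enough for \<open>d\<close> compatible intervals to fit below the scale of stage \<open>s\<close>.\<close>

definition scale :: "nat \<Rightarrow> real" where
  "scale s = 1 / (2 * real d) ^ (T - s)"

definition low :: "nat \<Rightarrow> real" where
  "low s = scale s / real d"

lemma scale_pos: "scale s > 0"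
  using d by (simp add: scale_def)

lemma low_pos: "low s > 0"
  using d scale_pos[of s] by (simp add: low_def)

lemma scale_le: "s < T \<Longrightarrow> 2 * real d * scale s \<le> 1"
proof -
  assume "s < T"
  then have "2 * real d * 1 \<le> 2 * real d * (2 * real d) ^ (T - Suc s)"
    using d by (intro mult_left_mono one_le_power) auto
  also have "\<dots> = (2 * real d) ^ (T - s)"
    using \<open>s < T\<close> by (metis Suc_diff_Suc power_Suc)
  finally show ?thesis using d by (simp add: scale_def)
qed

lemma scale_le_quarter: "s < T \<Longrightarrow> scale s \<le> 1 / 4"
proof -
  assume "s < T"
  have "4 * scale s \<le> 2 * real d * scale s"
    using d scale_pos[of s] by (intro mult_right_mono) auto
  then show ?thesis using scale_le[OF \<open>s < T\<close>] by linarith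
qed

lemma low_le: "2 * low s \<le> scale s"
  using d scale_pos[of s] by (simp add: low_def field_simps)

text \<open>Consecutive scales differ by the factor \<open>2 * d\<close>, whereas
  \<open>low s\<close> is below \<open>scale s\<close> only by the factor \<open>d\<close>; a factor
  2 remains.\<close>

lemma scale_less_low:
  assumes "r < s" "s < T"
  shows "scale r < low s"
proof -
  have "(2 * real d) * (2 * real d) ^ (T - s) = (2 * real d) ^ Suc (T - s)" by simp
  also have "\<dots> \<le> (2 * real d) ^ (T - r)"
    using assms d by (intro power_increasing) auto
  finally have "(2 * real d) * (2 * real d) ^ (T - s) \<le> (2 * real d) ^ (T - r)" .
  moreover have pos: "(2 * real d) ^ (T - s) > 0" using d by simp
  ultimately have "real d * (2 * real d) ^ (T - s) < (2 * real d) ^ (T - r)"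
    using mult_pos_pos[OF _ pos, of "real d"] d by linarith
  then have "1 / (2 * real d) ^ (T - r) < 1 / (real d * (2 * real d) ^ (T - s))"
    using pos d by (intro divide_strict_left_mono) auto
  then show ?thesis by (simp add: scale_def low_def mult.commute)
qed

text \<open>Coordinate \<open>t mod d\<close> is owned by interval \<open>t\<close>. In a coordinate
  owned by an earlier interval of the stage the range admits both \<open>2 * scale\<close>, which
  conflicts with the owner, and \<open>low\<close>, which does not.\<close>

definition shaped_item :: "nat \<Rightarrow> real \<Rightarrow> winterval \<Rightarrow> bool" where
  "shaped_item t x J \<longleftrightarrow> lend J = x \<and> rend J = x + 1 \<and>
     weight J (t mod d) = 1 - scale (t div d) \<and>
     (\<forall>j<d. j \<noteq> t mod d \<longrightarrow> low (t div d) \<le> weight J j \<and> weight J j \<le> 2 * scale (t div d)) \<and>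
     (\<forall>j<d. t mod d < j \<longrightarrow> weight J j = low (t div d))"

definition shaped :: "history \<Rightarrow> bool" where
  "shaped h \<longleftrightarrow> (\<forall>t<length h. shaped_item t (pos (take t h)) (fst (h ! t)))"

text \<open>Ordered pairs are quantified, so each of two intervals of equal hue has weight
  \<open>low\<close> in the coordinate owned by the other. Equal hues fit together off-line, yet
  within a stage Algorithm has given them distinct colors.\<close>

definition hued :: "history \<Rightarrow> (nat \<Rightarrow> nat) \<Rightarrow> bool" where
  "hued h hue \<longleftrightarrow> (\<forall>t<length h. hue t < 2 * q) \<and>
     (\<forall>t<length h. \<forall>u<length h. t \<noteq> u \<and> t div d = u div d \<and> hue t = hue u \<longrightarrow>
        weight (fst (h ! t)) (u mod d) = low (t div d) \<and> snd (h ! t) \<noteq> snd (h ! u))"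

definition uses :: "history \<Rightarrow> nat \<Rightarrow> nat \<Rightarrow> nat set" where
  "uses h s \<gamma> = {t. t < length h \<and> t div d = s \<and> snd (h ! t) = \<gamma>}"

definition consistent :: "history \<Rightarrow> bool" where
  "consistent h \<longleftrightarrow> kd_coloring k d (map fst h) (map snd h) \<and> shaped h \<and> (\<exists>hue. hued h hue) \<and>
     (\<forall>s \<gamma>. card (uses h s \<gamma>) \<le> q)"

lemma huedI:
  assumes "\<And>t. t < length h \<Longrightarrow> hue t < 2 * q"
    and "\<And>t u. t < length h \<Longrightarrow> u < length h \<Longrightarrow> t \<noteq> u \<Longrightarrow> t div d = u div d \<Longrightarrow> hue t = hue u \<Longrightarrow>
      weight (fst (h ! t)) (u mod d) = low (t div d) \<and> snd (h ! t) \<noteq> snd (h ! u)"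
  shows "hued h hue"
  using assms by (simp add: hued_def)

lemma huedD:
  assumes "hued h hue" "t < length h" "u < length h" "t \<noteq> u" "t div d = u div d" "hue t = hue u"
  shows "weight (fst (h ! t)) (u mod d) = low (t div d)" "snd (h ! t) \<noteq> snd (h ! u)"
  using assms by (simp_all add: hued_def)

lemma finite_uses: "finite (uses h s \<gamma>)"
  by (simp add: uses_def)

lemma uses_append:
  "uses (h @ [(J, c)]) s \<gamma> =
    (if s = length h div d \<and> \<gamma> = c then insert (length h) (uses h s \<gamma>) else uses h s \<gamma>)"
  by (auto simp: uses_def nth_append less_Suc_eq)

text \<open>The larger left endpoint lies in both intervals, as the left endpoints differ by at most
  1.\<close>

lemma shaped_meet:
  assumes "shaped h" "s < length h" "t < length h" "s div d = t div d"
  shows "\<exists>x. x \<in> points (fst (h ! s)) \<and> x \<in> points (fst (h ! t))"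
proof -
  have "\<bar>pos (take s h) - pos (take t h)\<bar> \<le> 1"
    using assms by (intro pos_close) auto
  then have "max (pos (take s h)) (pos (take t h)) \<in> points (fst (h ! s)) \<inter> points (fst (h ! t))"
    using assms by (auto simp: shaped_def shaped_item_def points_def)
  then show ?thesis by blast
qed

lemma shaped_unit_weighted:
  assumes "shaped h" "length h \<le> T * d" "J \<in> set (map fst h)"
  shows "unit_weighted d J"
proof -
  obtain t where t: "t < length h" "J = fst (h ! t)" using assms(3) by (auto simp: in_set_conv_nth)
  then have "t div d < T" using assms(2) d by (simp add: less_mult_imp_div_less)
  then have sc: "scale (t div d) \<le> 1 / 4" by (rule scale_le_quarter)
  have "0 \<le> weight J j \<and> weight J j \<le> 1" if "j < d" for j
  proof (cases "j = t mod d")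
    case True
    then have "weight J j = 1 - scale (t div d)" using assms(1) t by (simp add: shaped_def shaped_item_def)
    then show ?thesis using sc scale_pos[of "t div d"] by linarith
  next
    case False
    then have "low (t div d) \<le> weight J j \<and> weight J j \<le> 2 * scale (t div d)"
      using assms(1) t that by (simp add: shaped_def shaped_item_def)
    then show ?thesis using sc low_pos[of "t div d"] by linarith
  qed
  then show ?thesis using assms(1) t by (auto simp: shaped_def shaped_item_def unit_weighted_def)
qed

text \<open>Colors used \<open>q\<close> times occupy disjoint sets of \<open>q\<close> intervals
  among fewer than \<open>d\<close>, so there are fewer such colors than \<open>q\<close>-element
  sets of hues.\<close>

lemma exists_fresh_hue_set:
  assumes "\<forall>\<gamma>. card (uses h s \<gamma>) \<le> q"
    and few: "card {t. t < length h \<and> t div d = s} < d"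
  shows "\<exists>A. A \<subseteq> {..<2 * q} \<and> card A = q \<and> (\<forall>\<gamma>. card (uses h s \<gamma>) = q \<longrightarrow> hue ` uses h s \<gamma> \<noteq> A)"
proof -
  define full where "full = {\<gamma> \<in> snd ` set h. card (uses h s \<gamma>) = q}"
  have "q * card full = (\<Sum>\<gamma>\<in>full. card (uses h s \<gamma>))" by (simp add: full_def)
  also have "\<dots> = card (\<Union>\<gamma>\<in>full. uses h s \<gamma>)"
    by (rule card_UN_disjoint[symmetric]) (auto simp: full_def uses_def)
  also have "\<dots> \<le> card {t. t < length h \<and> t div d = s}"
    by (rule card_mono) (auto simp: uses_def)
  also have "\<dots> < q * ((2 * q) choose q)" using few dq by simp
  finally have "card full < (2 * q) choose q" using q by simp
  moreover have "card ((\<lambda>\<gamma>. hue ` uses h s \<gamma>) ` full) \<le> card full"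
    by (rule card_image_le) (simp add: full_def)
  moreover have "card {A. A \<subseteq> {..<2 * q} \<and> card A = q} = (2 * q) choose q"
    by (simp add: n_subsets)
  ultimately have "\<not> {A. A \<subseteq> {..<2 * q} \<and> card A = q} \<subseteq> (\<lambda>\<gamma>. hue ` uses h s \<gamma>) ` full"
    using card_mono[of "(\<lambda>\<gamma>. hue ` uses h s \<gamma>) ` full" "{A. A \<subseteq> {..<2 * q} \<and> card A = q}"]
    by (fastforce simp: full_def)
  then obtain A where A: "A \<subseteq> {..<2 * q}" "card A = q" "A \<notin> (\<lambda>\<gamma>. hue ` uses h s \<gamma>) ` full"
    by auto
  have "hue ` uses h s \<gamma> \<noteq> A" if \<gamma>: "card (uses h s \<gamma>) = q" for \<gamma>
  proof -
    have "uses h s \<gamma> \<noteq> {}" using \<gamma> q by auto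
    then have "\<gamma> \<in> full" using \<gamma> by (force simp: uses_def full_def)
    then show ?thesis using A(3) by auto
  qed
  then show ?thesis using A by blast
qed

text \<open>The new interval is made to conflict with all earlier ones of its stage whose hue lies
  outside a fresh set \<open>A\<close>. Whatever color Algorithm replies, its earlier uses in the
  stage have distinct hues in \<open>A\<close> that do not exhaust \<open>A\<close>, so a hue of
  \<open>A\<close> is left for the new interval.\<close>

lemma consistent_step:
  assumes h: "consistent h" and len: "length h < T * d"
  shows "\<exists>J. unit_weighted d J \<and>
      (\<forall>c. kd_coloring k d (map fst h @ [J]) (map snd h @ [c]) \<longrightarrow> consistent (h @ [(J, c)]))"
proof -
  define n s where "n = length h" and "s = n div d"
  have sT: "s < T" using len by (simp add: n_def s_def less_mult_imp_div_less)
  note shaped = h[unfolded consistent_def, THEN conjunct2, THEN conjunct1]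
  obtain hue where hue: "hued h hue" using h by (auto simp: consistent_def)
  have "{t. t < length h \<and> t div d = s} \<subseteq> {s * d..<n}"
    by (auto simp: n_def)
  then have "card {t. t < length h \<and> t div d = s} \<le> n - s * d"
    using card_mono[of "{s * d..<n}"] by fastforce
  moreover have "n - s * d < d" using d by (simp add: s_def minus_div_mult_eq_mod)
  ultimately have few: "card {t. t < length h \<and> t div d = s} < d" by linarith
  obtain A where A: "A \<subseteq> {..<2 * q}" "card A = q"
    "\<And>\<gamma>. card (uses h s \<gamma>) = q \<Longrightarrow> hue ` uses h s \<gamma> \<noteq> A"
    using exists_fresh_hue_set[OF _ few, of hue] h by (auto simp: consistent_def)
  define w where "w j = (if j = n mod d then 1 - scale s
    else if j < n mod d \<and> hue (s * d + j) \<notin> A then 2 * scale s else low s)" for j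
  define J where "J = WInterval (pos h) (pos h + 1) w"
  have w_bounds: "low s \<le> w j \<and> w j \<le> 2 * scale s" if "j \<noteq> n mod d" for j
    using that low_le[of s] scale_pos[of s] low_pos[of s] by (auto simp: w_def)
  have "shaped_item n (pos h) J"
    using w_bounds by (simp add: shaped_item_def J_def s_def) (simp add: w_def s_def)
  then have shaped': "shaped (h @ [(J, c)])" for c
    using shaped by (simp add: shaped_def nth_append less_Suc_eq n_def)
  have len': "length (h @ [(J, c)]) \<le> T * d" for c using len by simp
  have unit: "unit_weighted d J"
    using shaped_unit_weighted[OF shaped' len'] by simp
  have "consistent (h @ [(J, c)])"
    if c: "kd_coloring k d (map fst h @ [J]) (map snd h @ [c])" for c
  proof -
    have idx: "t = s * d + t mod d" "t mod d < n mod d" if "t < n" "t div d = s" for t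
    proof -
      show t: "t = s * d + t mod d" using that by (metis div_mult_mod_eq)
      have "n = s * d + n mod d" by (simp add: s_def)
      with t that show "t mod d < n mod d" by linarith
    qed
    have in_A: "hue t \<in> A" if t: "t \<in> uses h s c" for t
    proof (rule ccontr)
      assume notin: "hue t \<notin> A"
      have t': "t < n" "t div d = s" "snd (h ! t) = c" using t by (auto simp: uses_def n_def)
      obtain x where x: "x \<in> points (fst (h ! t))" "x \<in> points J"
        using shaped_meet[OF shaped'[of c], of t n] t' by (auto simp: n_def s_def nth_append)
      have "(map snd h @ [c]) ! t \<noteq> (map snd h @ [c]) ! n"
      proof (rule conflicting_colors_distinct[OF c])
        show "unit_weighted d I" if "I \<in> set (map fst h @ [J])" for I
          using that shaped_unit_weighted[OF shaped] len unit by auto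
        show "t < length (map fst h @ [J])" "n < length (map fst h @ [J])" "t \<noteq> n"
          using t' by (auto simp: n_def)
        show "x \<in> points ((map fst h @ [J]) ! t)" "x \<in> points ((map fst h @ [J]) ! n)"
          using x t' by (auto simp: nth_append n_def)
        show "t mod d < d" using d by simp
        have "weight (fst (h ! t)) (t mod d) = 1 - scale s"
          using shaped t' by (auto simp: shaped_def shaped_item_def n_def)
        moreover have "w (t mod d) = 2 * scale s"
          using idx[OF t'(1,2)] notin by (simp add: w_def)
        ultimately show "1 < weight ((map fst h @ [J]) ! t) (t mod d) +
            weight ((map fst h @ [J]) ! n) (t mod d)"
          using t'(1) scale_pos[of s] by (auto simp: nth_append n_def J_def)
      qed
      then show False using t' by (auto simp: nth_append n_def)
    qed
    have inj: "inj_on hue (uses h s c)"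
    proof (rule inj_onI, rule ccontr)
      fix t u assume "t \<in> uses h s c" "u \<in> uses h s c" "hue t = hue u" "t \<noteq> u"
      then show False using huedD(2)[OF hue, of t u] by (simp add: uses_def)
    qed
    have cardA: "card (hue ` uses h s c) = card (uses h s c)" using inj by (rule card_image)
    have finA: "finite A" using A(1) finite_subset by blast
    have sub: "hue ` uses h s c \<subseteq> A" using in_A by blast
    \<comment> \<open>Hues are distinct on the uses of \<open>c\<close>, so equality would mean
      \<open>q\<close> uses with hue set \<open>A\<close>, which the choice of \<open>A\<close>
      excludes.\<close>
    have ne: "hue ` uses h s c \<noteq> A" using A(2) A(3)[of c] cardA by auto
    have less: "card (uses h s c) < q"
      using psubset_card_mono[OF finA, of "hue ` uses h s c"] sub ne cardA A(2) by auto
    \<comment> \<open>the hue is fixed only now, after Algorithm's reply \<open>c\<close>\<close>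
    obtain x where x: "x \<in> A" "x \<notin> hue ` uses h s c" using sub ne by blast
    define hue' where "hue' = hue(n := x)"
    have low_w: "w (t mod d) = low s" if "t < n" "t div d = s" "hue t = x" for t
      using idx[OF that(1,2)] that x by (auto simp: w_def)
    \<comment> \<open>Coordinate \<open>n mod d\<close> comes after the one owned by
      \<open>t\<close>, where \<open>shaped_item\<close> prescribes \<open>low\<close>.\<close>
    have low_h: "weight (fst (h ! t)) (n mod d) = low s" if "t < n" "t div d = s" for t
      using idx[OF that] shaped that d by (auto simp: shaped_def shaped_item_def n_def)
    have "hued (h @ [(J, c)]) hue'"
    proof (rule huedI)
      fix t assume "t < length (h @ [(J, c)])"
      then show "hue' t < 2 * q"
        using hue x A(1) by (auto simp: hued_def hue'_def n_def less_Suc_eq)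
    next
      fix t u
      assume tu: "t < length (h @ [(J, c)])" "u < length (h @ [(J, c)])" "t \<noteq> u"
        "t div d = u div d" "hue' t = hue' u"
      consider "t < n" "u < n" | "t = n" "u < n" | "t < n" "u = n"
        using tu by (auto simp: n_def less_Suc_eq)
      then show "weight (fst ((h @ [(J, c)]) ! t)) (u mod d) = low (t div d) \<and>
          snd ((h @ [(J, c)]) ! t) \<noteq> snd ((h @ [(J, c)]) ! u)"
      proof cases
        case 1
        then show ?thesis using tu hue by (auto simp: hued_def hue'_def n_def nth_append)
      next
        case 2
        then have "u div d = s" "hue u = x" using tu by (auto simp: hue'_def s_def)
        moreover from this have "snd (h ! u) \<noteq> c" using x 2 by (auto simp: uses_def n_def)
        ultimately show ?thesis using low_w[of u] 2 tu(4) by (auto simp: nth_append n_def J_def)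
      next
        case 3
        then have "t div d = s" "hue t = x" using tu by (auto simp: hue'_def s_def)
        moreover from this have "snd (h ! t) \<noteq> c" using x 3 by (auto simp: uses_def n_def)
        ultimately show ?thesis using low_h[of t] 3 by (auto simp: nth_append n_def J_def)
      qed
    qed
    moreover have "card (uses (h @ [(J, c)]) r \<gamma>) \<le> q" for r \<gamma>
      using h less by (auto simp: uses_append consistent_def s_def n_def finite_uses card_insert_if)
    ultimately show ?thesis using c shaped' by (auto simp: consistent_def)
  qed
  then show ?thesis using unit by blast
qed

section \<open>Color counts for Algorithm and off-line coloring from consistency\<close>

lemma stage_eq: "{t. t div d = s} = {s * d..<Suc s * d}"
proof (intro set_eqI iffI)
  fix t assume "t \<in> {t. t div d = s}"
  then have "t = s * d + t mod d" by (metis div_mult_mod_eq mem_Collect_eq)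
  moreover have "t mod d < d" using d by simp
  ultimately show "t \<in> {s * d..<Suc s * d}" by simp
next
  fix t assume "t \<in> {s * d..<Suc s * d}"
  then show "t \<in> {t. t div d = s}" by (auto intro!: div_nat_eqI simp: mult.commute)
qed

lemma shaped_itemD:
  assumes "consistent h" "t < length h"
  shows "shaped_item t (pos (take t h)) (fst (h ! t))"
  using assms by (simp add: consistent_def shaped_def)

lemma points_item:
  assumes "consistent h" "t < length h"
  shows "points (fst (h ! t)) = {pos (take t h)..pos (take t h) + 1}"
  using shaped_itemD[OF assms] by (simp add: shaped_item_def points_def)

text \<open>In the coordinate owned by \<open>s\<close> the later interval weighs at least
  \<open>low\<close> of its own stage, which exceeds the slack \<open>scale (s div d)\<close>. If
  both own this coordinate, both weights are at least 3/4.\<close>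

lemma different_stages_conflict:
  assumes h: "consistent h" "length h \<le> T * d" and t: "t < length h" and st: "s div d < t div d"
    and x: "x \<in> points (fst (h ! s))" "x \<in> points (fst (h ! t))"
  shows "snd (h ! s) \<noteq> snd (h ! t)"
proof -
  have s: "s < length h" using st t div_le_mono[of t s d] by linarith
  have tT: "t div d < T" using t h(2) by (simp add: less_mult_imp_div_less)
  have "map snd h ! s \<noteq> map snd h ! t"
  proof (rule conflicting_colors_distinct[of k d "map fst h"])
    show "kd_coloring k d (map fst h) (map snd h)" using h(1) by (simp add: consistent_def)
    show "unit_weighted d J" if "J \<in> set (map fst h)" for J
      using h that by (intro shaped_unit_weighted) (auto simp: consistent_def)
    show "s < length (map fst h)" "t < length (map fst h)" "s \<noteq> t" using s t st by auto
    show "x \<in> points (map fst h ! s)" "x \<in> points (map fst h ! t)" using x s t by auto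
    show j: "s mod d < d" using d by simp
    have "weight (fst (h ! s)) (s mod d) = 1 - scale (s div d)"
      using shaped_itemD[OF h(1) s] by (simp add: shaped_item_def)
    moreover have "weight (fst (h ! t)) (s mod d) > scale (s div d)"
    proof (cases "s mod d = t mod d")
      case True
      then have "weight (fst (h ! t)) (s mod d) = 1 - scale (t div d)"
        using shaped_itemD[OF h(1) t] by (simp add: shaped_item_def)
      then show ?thesis
        using scale_le_quarter[of "s div d"] scale_le_quarter[OF tT] st tT by simp
    next
      case False
      then have "weight (fst (h ! t)) (s mod d) \<ge> low (t div d)"
        using shaped_itemD[OF h(1) t] j by (simp add: shaped_item_def)
      then show ?thesis using scale_less_low[OF st tT] by linarith
    qed
    ultimately show "1 < weight (map fst h ! s) (s mod d) + weight (map fst h ! t) (s mod d)"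
      using s t by simp
  qed
  then show ?thesis using s t by simp
qed

text \<open>Intervals through \<open>x\<close> with a common color must come from one stage, where a
  color occurs at most \<open>q\<close> times.\<close>

lemma card_le_colors:
  assumes h: "consistent h" "length h \<le> T * d" and X: "X \<subseteq> {..<length h}"
    and x: "\<And>t. t \<in> X \<Longrightarrow> x \<in> points (fst (h ! t))"
  shows "card X \<le> q * card ((\<lambda>t. snd (h ! t)) ` X)"
proof -
  have fin: "finite X" using X finite_subset by blast
  have "card {t \<in> X. snd (h ! t) = \<gamma>} \<le> q" for \<gamma>
  proof (cases "{t \<in> X. snd (h ! t) = \<gamma>} = {}")
    case False
    then obtain s where s: "s \<in> X" "snd (h ! s) = \<gamma>" by blast
    have "t div d = s div d" if "t \<in> X" "snd (h ! t) = \<gamma>" for t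
      using different_stages_conflict[OF h, of s t x] different_stages_conflict[OF h, of t s x]
        s that x X by (metis lessThan_iff linorder_neqE_nat subsetD)
    then have "{t \<in> X. snd (h ! t) = \<gamma>} \<subseteq> uses h (s div d) \<gamma>"
      using X by (auto simp: uses_def)
    then have "card {t \<in> X. snd (h ! t) = \<gamma>} \<le> card (uses h (s div d) \<gamma>)"
      by (rule card_mono[OF finite_uses])
    then show ?thesis using h(1) by (meson consistent_def order_trans)
  next
    case True
    then show ?thesis by (simp only: card.empty)
  qed
  then have "(\<Sum>\<gamma>\<in>(\<lambda>t. snd (h ! t)) ` X. card {t \<in> X. snd (h ! t) = \<gamma>})
      \<le> (\<Sum>\<gamma>\<in>(\<lambda>t. snd (h ! t)) ` X. q)"
    by (intro sum_mono) simp
  moreover have "card X = (\<Sum>\<gamma>\<in>(\<lambda>t. snd (h ! t)) ` X. card {t \<in> X. snd (h ! t) = \<gamma>})"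
    using sum.image_gen[OF fin, of "\<lambda>_. 1::nat" "\<lambda>t. snd (h ! t)"] by simp
  ultimately show ?thesis by (simp add: mult.commute)
qed

text \<open>If the owner of \<open>j\<close> is in \<open>X\<close>, the others add at most
  \<open>d * low s\<close>, which is exactly its slack \<open>scale s\<close>. Otherwise at most
  \<open>d\<close> weights of at most \<open>2 * scale s\<close> add up to at most 1.\<close>

lemma hue_class_compatible:
  assumes h: "consistent h" "hued h hue" and s: "s < T"
    and X: "X \<subseteq> {..<length h} \<inter> {t. t div d = s}" and same: "\<And>t. t \<in> X \<Longrightarrow> hue t = v" and j: "j < d"
  shows "(\<Sum>t\<in>X. weight (fst (h ! t)) j) \<le> 1"
proof -
  have fin: "finite X" using X finite_subset by blast
  have "card X \<le> card {t. t div d = s}"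
    using X by (intro card_mono) (auto simp: stage_eq)
  then have card: "card X \<le> d" by (simp add: stage_eq)
  show ?thesis
  proof (cases "\<exists>u\<in>X. u mod d = j")
    case True
    then obtain u where u: "u \<in> X" "u mod d = j" by blast
    have "(\<Sum>t\<in>X. weight (fst (h ! t)) j) =
        weight (fst (h ! u)) j + (\<Sum>t\<in>X - {u}. weight (fst (h ! t)) j)"
      using fin u by (simp add: sum.remove)
    also have "weight (fst (h ! u)) j = 1 - scale s"
      using shaped_itemD[OF h(1), of u] u X by (auto simp: shaped_item_def)
    also have "(\<Sum>t\<in>X - {u}. weight (fst (h ! t)) j) = (\<Sum>t\<in>X - {u}. low s)"
    proof (rule sum.cong)
      fix t assume t: "t \<in> X - {u}"
      then have "t < length h" "u < length h" "t div d = s" "u div d = s" "hue t = hue u"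
        using u X same by auto
      then show "weight (fst (h ! t)) j = low s"
        using huedD(1)[OF h(2), of t u] u t by auto
    qed simp
    also have "\<dots> = (card X - 1) * low s" using u fin by simp
    also have "\<dots> \<le> real d * low s"
      using card low_pos[of s] by (intro mult_right_mono) auto
    also have "real d * low s = scale s" using d by (simp add: low_def)
    finally show ?thesis by simp
  next
    case False
    have "(\<Sum>t\<in>X. weight (fst (h ! t)) j) \<le> (\<Sum>t\<in>X. 2 * scale s)"
    proof (rule sum_mono)
      fix t assume t: "t \<in> X"
      then have "t < length h" "t div d = s" "j \<noteq> t mod d" using X False by auto
      then show "weight (fst (h ! t)) j \<le> 2 * scale s"
        using shaped_itemD[OF h(1), of t] j by (auto simp: shaped_item_def)
    qed
    also have "\<dots> \<le> real d * (2 * scale s)"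
      using card scale_pos[of s] by (simp add: mult_right_mono)
    also have "\<dots> \<le> 1" using scale_le[OF s] by (simp add: mult_ac)
    finally show ?thesis .
  qed
qed

text \<open>Each slot receives a palette of \<open>Q\<close> colors, enough for the groups of one
  stage; disjoint stages sharing a slot reuse the palette.\<close>

lemma colorable_by_slots:
  fixes slot :: "nat \<Rightarrow> nat"
  assumes h: "consistent h" "length h \<le> T * d" and k: "k \<ge> 1"
    and slot: "\<And>s. s < T \<Longrightarrow> slot s < m"
    and apart: "\<And>t u. t < length h \<Longrightarrow> u < length h \<Longrightarrow> t div d \<noteq> u div d \<Longrightarrow>
      slot (t div d) = slot (u div d) \<Longrightarrow> points (fst (h ! t)) \<inter> points (fst (h ! u)) = {}"
  shows "colorable k d (real m * (real d / real k + 2 * real q)) (map fst h)"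
proof -
  obtain hue where hue: "hued h hue" using h by (auto simp: consistent_def)
  define Q where "Q = nat \<lfloor>real d / real k + 2 * real q\<rfloor>"
  define stg where "stg s = {..<length h} \<inter> {t. t div d = s}" for s
  have Q: "real Q \<le> real d / real k + 2 * real q" "real d / real k + 2 * real q < real Q + 1"
    by (auto simp: Q_def)
  have "\<exists>f. f ` stg s \<subseteq> {..<Q} \<and>
      (\<forall>t\<in>stg s. \<forall>u\<in>stg s. f t = f u \<longrightarrow> hue t = hue u) \<and>
      (\<forall>v. card {t \<in> stg s. f t = v} \<le> k)" for s
  proof -
    have "card (stg s) \<le> card {t. t div d = s}"
      by (intro card_mono) (auto simp: stage_eq stg_def)
    then have "card (stg s) \<le> d" by (simp add: stage_eq)
    moreover have "d + k * (2 * q) < k * Suc Q"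
    proof -
      have "real d + real k * (2 * real q) < real k * (real Q + 1)"
        using Q(2) k by (simp add: field_simps)
      then have "real (d + k * (2 * q)) < real (k * Suc Q)" by (simp add: algebra_simps)
      then show ?thesis by linarith
    qed
    ultimately have lt: "card (stg s) + k * (2 * q) < k * Suc Q" by linarith
    have "hue ` stg s \<subseteq> {..<2 * q}" using hue by (auto simp: stg_def hued_def)
    from split_into_groups[OF _ this k lt] show ?thesis
      by (metis stg_def finite_Int finite_lessThan)
  qed
  then obtain F where F: "\<And>s. F s ` stg s \<subseteq> {..<Q}"
    "\<And>s t u. t \<in> stg s \<Longrightarrow> u \<in> stg s \<Longrightarrow> F s t = F s u \<Longrightarrow> hue t = hue u"
    "\<And>s v. card {t \<in> stg s. F s t = v} \<le> k"
    by metis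
  \<comment> \<open>Division by \<open>Q\<close> recovers the slot, since group numbers are below
    \<open>Q\<close>.\<close>
  define color where "color t = slot (t div d) * Q + F (t div d) t" for t
  define cs where "cs = map color [0..<length h]"
  have FQ: "F (t div d) t < Q" if "t < length h" for t
    using F(1)[of "t div d"] that by (auto simp: stg_def)
  have stage_T: "t div d < T" if "t < length h" for t
    using that h(2) by (simp add: less_mult_imp_div_less)
  have coloring: "kd_coloring k d (map fst h) cs"
    unfolding kd_coloring_def
  proof (intro conjI allI)
    show "length cs = length (map fst h)" by (simp add: cs_def)
  next
    fix \<gamma> x
    define X where "X = class_at (map fst h) cs \<gamma> x"
    have X: "t < length h" "color t = \<gamma>" "x \<in> points (fst (h ! t))" if "t \<in> X" for t
      using that by (auto simp: X_def class_at_def cs_def)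
    have "card X \<le> k \<and> (\<forall>j<d. (\<Sum>t\<in>X. weight (map fst h ! t) j) \<le> 1)"
    proof (cases "X = {}")
      case False
      then obtain u where u: "u \<in> X" by blast
      define s where "s = u div d"
      have same: "t div d = s \<and> F s t = F s u" if t: "t \<in> X" for t
      proof -
        have eq: "slot (t div d) * Q + F (t div d) t = slot s * Q + F s u"
          using X(2)[OF t] X(2)[OF u] by (simp add: color_def s_def)
        have "slot (t div d) = (slot (t div d) * Q + F (t div d) t) div Q"
          using FQ[OF X(1)[OF t]] by simp
        also have "\<dots> = slot s" using eq FQ[OF X(1)[OF u]] by (simp add: s_def)
        finally have slots: "slot (t div d) = slot s" .
        then have "t div d = s" using apart[of t u] X t u by (auto simp: s_def)
        then show ?thesis using eq by simp
      qed
      have sub: "X \<subseteq> {t \<in> stg s. F s t = F s u}"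
        using same X by (auto simp: stg_def)
      have "finite {t \<in> stg s. F s t = F s u}" by (simp add: stg_def)
      then have "card X \<le> card {t \<in> stg s. F s t = F s u}" using sub by (rule card_mono)
      then have "card X \<le> k" using F(3) order_trans by blast
      moreover have "(\<Sum>t\<in>X. weight (map fst h ! t) j) \<le> 1" if j: "j < d" for j
      proof -
        have "(\<Sum>t\<in>X. weight (map fst h ! t) j) = (\<Sum>t\<in>X. weight (fst (h ! t)) j)"
          using X by (intro sum.cong) auto
        also have "\<dots> \<le> 1"
        proof (rule hue_class_compatible[OF h(1) hue])
          show "s < T" using stage_T X(1)[OF u] by (simp add: s_def)
          show "X \<subseteq> {..<length h} \<inter> {t. t div d = s}" using sub by (auto simp: stg_def)
          have "u \<in> stg s" using X(1)[OF u] by (simp add: stg_def s_def)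
          then show "hue t = hue u" if "t \<in> X" for t
            using F(2)[of t s u] that sub by auto
        qed fact
        finally show ?thesis .
      qed
      ultimately show ?thesis by blast
    qed simp
    then show "card (class_at (map fst h) cs \<gamma> x) \<le> k"
      "\<And>j. j < d \<longrightarrow> (\<Sum>i\<in>class_at (map fst h) cs \<gamma> x. weight (map fst h ! i) j) \<le> 1"
      by (simp_all add: X_def)
  qed
  have "set cs \<subseteq> {..<m * Q}"
  proof (clarsimp simp: cs_def)
    fix t assume t: "t < length h"
    have "color t < (slot (t div d) + 1) * Q" using FQ[OF t] by (simp add: color_def)
    also have "\<dots> \<le> m * Q" using slot[OF stage_T[OF t]] by (intro mult_right_mono) auto
    finally show "color t < m * Q" .
  qed
  then have "card (set cs) \<le> m * Q" using card_mono[of "{..<m * Q}" "set cs"] by simp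
  then have "real (card (set cs)) \<le> real m * real Q" by (metis of_nat_le_iff of_nat_mult)
  also have "\<dots> \<le> real m * (real d / real k + 2 * real q)" using Q(1) by (intro mult_left_mono) auto
  finally show ?thesis using coloring by (auto simp: colorable_def)
qed

end

section \<open>Arrangement of the blocks\<close>

locale unit_game =
  fixes d q k m :: nat
  assumes d: "d \<ge> 2" and q: "q \<ge> 1" and dq: "d \<le> q * ((2 * q) choose q)" and k: "k \<ge> 1"
begin

definition p :: nat where
  "p = m div 2"

text \<open>Indices 0, 1, 2 stand for the blocks \<open>A\<close>, \<open>B1\<close>,
  \<open>B2\<close>, cut off at the rounds played so far.\<close>

definition group :: "history \<Rightarrow> nat \<Rightarrow> nat list" where
  "group h i = map snd (take (p * d) (drop (i * (p * d)) h))"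

definition new :: "history \<Rightarrow> nat \<Rightarrow> bool list" where
  "new h i = map (\<lambda>c. c \<notin> set (group h 0)) (group h i)"

text \<open>The threshold is half of the \<open>p * d / q\<close> colors that a block of
  \<open>p\<close> stages with a common point forces.\<close>

definition many_new :: "history \<Rightarrow> bool" where
  "many_new h \<longleftrightarrow> p * d \<le> 2 * q * card (set (group h 1) - set (group h 0))"

text \<open>Left endpoint of the next \<open>B1\<close> interval, and the point where
  \<open>C\<close> ends if \<open>B1\<close> succeeds. Offsets stay within 1/8 of 7/4 here and of
  5/4 in \<open>gap2\<close>: \<open>B1\<close> and such a \<open>B2\<close> start right of 1 and
  contain 2, \<open>C\<close> contains 1, and a \<open>C\<close> ending at \<open>gap2\<close> lies
  left of \<open>B1\<close>.\<close>

definition gap1 :: "history \<Rightarrow> real" where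
  "gap1 h = 7 / 4 + sep (new h 1) / 4"

definition gap2 :: "history \<Rightarrow> real" where
  "gap2 h = 5 / 4 + sep (new h 2) / 4"

text \<open>After a successful \<open>B1\<close> the block \<open>B2\<close> is played out of the way, at 10, merely to keep the
  number of rounds constant.\<close>

definition pos :: "history \<Rightarrow> real" where
  "pos h = (if length h < p * d then 0
     else if length h < 2 * (p * d) then gap1 h
     else if length h < 3 * (p * d) then (if many_new h then 10 else gap2 h)
     else (if many_new h then gap1 h else gap2 h) - 1)"

lemma gap_bounds: "13 / 8 < gap1 h" "gap1 h < 15 / 8" "9 / 8 < gap2 h" "gap2 h < 11 / 8"
  using abs_sep[of "new h 1"] abs_sep[of "new h 2"] by (auto simp: gap1_def gap2_def)

lemma group_take: "group (take t h) i = take (t - i * (p * d)) (group h i)"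
  by (simp add: group_def drop_take take_map min.commute)

lemma length_group: "length h \<ge> Suc i * (p * d) \<Longrightarrow> length (group h i) = p * d"
  by (simp add: group_def)

lemma length_group_le: "length (group h i) \<le> p * d"
  by (simp add: group_def)

lemma new_take: "t \<ge> p * d \<Longrightarrow> new (take t h) i = take (t - i * (p * d)) (new h i)"
  using length_group_le[of h 0] by (simp add: new_def group_take take_map)

text \<open>From this round on \<open>A\<close> and \<open>B1\<close> are complete, so the verdict
  is final.\<close>

lemma many_new_take: "t \<ge> 2 * (p * d) \<Longrightarrow> many_new (take t h) = many_new h"
  using length_group_le[of h 0] length_group_le[of h 1] by (simp add: many_new_def group_take)

lemma length_new_le: "length (new h i) \<le> p * d"
  by (simp add: new_def length_group_le)

lemma gap1_take: "t \<ge> 2 * (p * d) \<Longrightarrow> gap1 (take t h) = gap1 h"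
  using length_new_le[of h 1] by (simp add: gap1_def new_take)

lemma gap2_take: "t \<ge> 3 * (p * d) \<Longrightarrow> gap2 (take t h) = gap2 h"
  using length_new_le[of h 2] by (simp add: gap2_def new_take)

text \<open>Block boundaries are multiples of \<open>d\<close>, so a stage stays in one block, and
  within a block left endpoints vary by less than 1/4.\<close>

lemma pos_close:
  assumes "s \<le> length h" "t \<le> length h" "s div d = t div d"
  shows "\<bar>pos (take s h) - pos (take t h)\<bar> \<le> 1"
proof -
  have less: "s < i * (p * d) \<longleftrightarrow> t < i * (p * d)" for i
    using assms(3) d div_less_iff_less_mult[of d s "i * p"] div_less_iff_less_mult[of d t "i * p"]
    by (simp add: mult.assoc)
  have len: "length (take s h) = s" "length (take t h) = t" using assms by auto
  consider "s < p * d" "t < p * d"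
    | "\<not> s < p * d" "\<not> t < p * d" "s < 2 * (p * d)" "t < 2 * (p * d)"
    | "\<not> s < p * d" "\<not> t < p * d" "\<not> s < 2 * (p * d)" "\<not> t < 2 * (p * d)"
      "s < 3 * (p * d)" "t < 3 * (p * d)"
    | "\<not> s < p * d" "\<not> t < p * d" "\<not> s < 2 * (p * d)" "\<not> t < 2 * (p * d)"
      "\<not> s < 3 * (p * d)" "\<not> t < 3 * (p * d)"
    using less[of 1] less[of 2] less[of 3] by linarith
  then show ?thesis
  proof cases
    case 1
    then show ?thesis by (simp add: pos_def len del: length_take)
  next
    case 2
    then show ?thesis
      using gap_bounds[of "take s h"] gap_bounds[of "take t h"] by (simp add: pos_def len abs_le_iff del: length_take)
  next
    case 3
    then show ?thesis
      using gap_bounds[of "take s h"] gap_bounds[of "take t h"]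
      by (simp add: pos_def len abs_le_iff many_new_take del: length_take)
  next
    case 4
    then show ?thesis by (simp add: pos_def len many_new_take gap1_take gap2_take del: length_take)
  qed
qed

text \<open>There are \<open>p\<close> stages in each of \<open>A\<close>, \<open>B1\<close>,
  \<open>B2\<close> and \<open>m - p\<close> in \<open>C\<close>.\<close>

sublocale hue_game d q k "m + 2 * p" pos
  using d q dq pos_close by unfold_locales

lemma p_le: "2 * p \<le> m" "p \<le> m" "m \<le> 2 * p + 1"
  by (simp_all add: p_def)

section \<open>Geometry of a completed play\<close>

context
  fixes h :: history
  assumes h: "consistent h" and len: "length h = (m + 2 * p) * d"
begin

abbreviation pt :: "nat \<Rightarrow> real set" where
  "pt t \<equiv> points (fst (h ! t))"

abbreviation colors :: "nat set \<Rightarrow> nat set" where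
  "colors X \<equiv> (\<lambda>t. snd (h ! t)) ` X"

lemma len_ge: "3 * (p * d) \<le> length h"
proof -
  have "(3 * p) * d \<le> (m + 2 * p) * d" using p_le by (intro mult_right_mono) auto
  then show ?thesis using len by (simp add: mult.assoc)
qed

lemma points_A: "t < p * d \<Longrightarrow> pt t = {0..1}"
  using points_item[OF h, of t] len_ge by (simp add: pos_def)

lemma points_B1:
  assumes "p * d \<le> t" "t < 2 * (p * d)"
  shows "pt t = {gap1 (take t h)..gap1 (take t h) + 1}"
  using points_item[OF h, of t] len_ge assms by (simp add: pos_def)

lemma points_B2:
  assumes "2 * (p * d) \<le> t" "t < 3 * (p * d)"
  shows "pt t = (if many_new h then {10..11} else {gap2 (take t h)..gap2 (take t h) + 1})"
  using points_item[OF h, of t] len_ge assms by (simp add: pos_def many_new_take)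

lemma points_C:
  assumes "3 * (p * d) \<le> t" "t < length h"
  shows "pt t = (if many_new h then {gap1 h - 1..gap1 h} else {gap2 h - 1..gap2 h})"
  using points_item[OF h, of t] assms by (simp add: pos_def many_new_take gap1_take gap2_take)

lemma set_group:
  assumes "i \<le> 2"
  shows "set (group h i) = colors {i * (p * d)..<Suc i * (p * d)}"
proof -
  have "i * (p * d) \<le> 2 * (p * d)" using assms by (rule mult_right_mono) simp
  then have le: "i * (p * d) \<le> length h" "p * d \<le> length (drop (i * (p * d)) h)"
    using len_ge unfolding length_drop by linarith+
  have "set (group h i) = snd ` ((!) (drop (i * (p * d)) h) ` {0..<p * d})"
    unfolding nth_image[OF le(2)] by (simp add: group_def)
  also have "\<dots> = (\<lambda>j. snd (h ! (i * (p * d) + j))) ` {..<p * d}"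
    using le(1) by (simp add: image_image lessThan_atLeast0)
  also have "\<dots> = colors ((+) (i * (p * d)) ` {..<p * d})" by (simp add: image_image)
  also have "(+) (i * (p * d)) ` {..<p * d} = {i * (p * d)..<Suc i * (p * d)}"
    by (simp add: lessThan_atLeast0 add.commute)
  finally show ?thesis .
qed

text \<open>The interval was placed by a prefix whose next digit is \<open>True\<close>, so the
  final value lies to its right.\<close>

lemma new_left_of_gap1:
  assumes t: "p * d \<le> t" "t < 2 * (p * d)" and new: "snd (h ! t) \<notin> set (group h 0)"
  shows "gap1 (take t h) < gap1 h"
proof -
  have "length (new h 1) = p * d" using len_ge by (simp add: new_def length_group)
  moreover have "new h 1 ! (t - p * d)"
    using t new len_ge by (simp add: new_def group_def)
  ultimately have "sep (take (t - p * d) (new h 1)) < sep (new h 1)"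
    using t by (intro sep_take_less) auto
  then show ?thesis using t by (simp add: gap1_def new_take)
qed

lemma new_left_of_gap2:
  assumes t: "2 * (p * d) \<le> t" "t < 3 * (p * d)" and new: "snd (h ! t) \<notin> set (group h 0)"
  shows "gap2 (take t h) < gap2 h"
proof -
  have "length (new h 2) = p * d" using len_ge by (simp add: new_def length_group)
  moreover have "new h 2 ! (t - 2 * (p * d))"
    using t new len_ge by (simp add: new_def group_def)
  ultimately have "sep (take (t - 2 * (p * d)) (new h 2)) < sep (new h 2)"
    using t by (intro sep_take_less) auto
  then show ?thesis using t by (simp add: gap2_def new_take)
qed

lemma group_conflict:
  assumes "t < i * (p * d)" "i * (p * d) \<le> u" "u < length h" "x \<in> pt t" "x \<in> pt u"
  shows "snd (h ! t) \<noteq> snd (h ! u)"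
proof (rule different_stages_conflict[OF h])
  have "t div d < i * p" using assms(1) by (simp add: less_mult_imp_div_less mult.assoc)
  moreover have "i * p \<le> u div d"
    using assms(2) d by (simp add: less_eq_div_iff_mult_less_eq mult.assoc)
  ultimately show "t div d < u div d" by linarith
qed (use assms len in auto)

section \<open>Counting Algorithm's colors\<close>

text \<open>\<open>A\<close>, the new colors \<open>B\<close> of the successful block, and
  \<open>C\<close> are disjoint sets of colors. \<open>A\<close> and \<open>B\<close> together
  supply \<open>3 * p * d / (2 * q)\<close> and \<open>C\<close> supplies
  \<open>(m - p) * d / q\<close>.\<close>

lemma many_colors: "(2 * m + p) * d \<le> 2 * q * card (set (map snd h))"
proof -
  define A B1 B2 C where "A = colors {..<p * d}" and "B1 = colors {p * d..<2 * (p * d)}"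
    and "B2 = colors {2 * (p * d)..<3 * (p * d)}" and "C = colors {3 * (p * d)..<length h}"
  have group: "set (group h 0) = A" "set (group h (Suc 0)) = B1" "set (group h 2) = B2"
    using set_group[of 0] set_group[of 1] set_group[of 2]
    by (simp_all add: A_def B1_def B2_def lessThan_atLeast0 mult_2)
  have fin: "finite A" "finite B1" "finite B2" "finite C"
    by (simp_all add: A_def B1_def B2_def C_def)
  have sub: "A \<union> B1 \<union> B2 \<union> C \<subseteq> set (map snd h)"
    using len_ge by (auto simp: A_def B1_def B2_def C_def)
  have le: "length h \<le> (m + 2 * p) * d" using len by simp
  have cardA: "p * d \<le> q * card A"
    using card_le_colors[OF h le, of "{..<p * d}" 0] len_ge points_A by (auto simp: A_def)
  have "length h - 3 * (p * d) = (m - p) * d"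
    using len p_le by (simp add: algebra_simps)
  moreover have "{3 * (p * d)..<length h} \<subseteq> {..<length h}" by auto
  ultimately have cardC: "(m - p) * d \<le> q * card C"
    using card_le_colors[OF h le, of "{3 * (p * d)..<length h}" "if many_new h then gap1 h else gap2 h"]
      points_C by (cases "many_new h") (auto simp: C_def)
  \<comment> \<open>All intervals of \<open>A\<close> and \<open>C\<close> share the point
    1.\<close>
  have "snd (h ! t) \<noteq> snd (h ! u)" if "t < p * d" "3 * (p * d) \<le> u" "u < length h" for t u
    using that gap_bounds[of h]
    by (intro group_conflict[of t 3 u 1]) (auto simp: points_A points_C)
  then have AC: "A \<inter> C = {}" by (force simp: A_def C_def)
  define B where "B = (if many_new h then B1 else B2) - A"
  \<comment> \<open>Intervals with new colors start left of the gap and reach beyond it, while those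
    of \<open>C\<close> end there.\<close>
  have BC: "B \<inter> C = {}"
  proof (rule ccontr)
    assume "B \<inter> C \<noteq> {}"
    then obtain c where c': "c \<in> B" "c \<in> C" by blast
    then obtain u where "3 * (p * d) \<le> u" "u < length h" "c = snd (h ! u)"
      by (auto simp: C_def)
    note c = c'(1) this
    show False
    proof (cases "many_new h")
      case True
      then obtain t where t: "p * d \<le> t" "t < 2 * (p * d)" "c = snd (h ! t)" "c \<notin> A"
        using c by (auto simp: B_def B1_def)
      then have "gap1 (take t h) < gap1 h" by (intro new_left_of_gap1) (auto simp: group)
      then have "gap1 h \<in> pt t" "gap1 h \<in> pt u"
        using points_B1[OF t(1,2)] points_C[OF c(2,3)] True gap_bounds[of h]
          gap_bounds[of "take t h"] by auto
      then show False using group_conflict[of t 3 u] t c by simp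
    next
      case False
      then obtain t where t: "2 * (p * d) \<le> t" "t < 3 * (p * d)" "c = snd (h ! t)" "c \<notin> A"
        using c by (auto simp: B_def B2_def)
      then have "gap2 (take t h) < gap2 h" by (intro new_left_of_gap2) (auto simp: group)
      then have "gap2 h \<in> pt t" "gap2 h \<in> pt u"
        using points_B2[OF t(1,2)] points_C[OF c(2,3)] False gap_bounds[of h]
          gap_bounds[of "take t h"] by auto
      then show False using group_conflict[of t 3 u] t c by simp
    qed
  qed
  have finB: "finite B" by (simp add: B_def fin)
  have "card (A \<union> B \<union> C) = card (A \<union> B) + card C"
    using AC BC fin finB by (intro card_Un_disjoint) auto
  moreover have "card (A \<union> B) = card A + card B"
    using fin finB by (intro card_Un_disjoint) (auto simp: B_def)
  moreover have "A \<union> B \<union> C \<subseteq> set (map snd h)"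
    using sub by (auto simp: B_def split: if_splits)
  then have "card (A \<union> B \<union> C) \<le> card (set (map snd h))" by (intro card_mono) auto
  ultimately have total: "card A + card B + card C \<le> card (set (map snd h))" by linarith
  \<comment> \<open>If \<open>B1\<close> fails, the common point 2 of \<open>B1\<close> and
    \<open>B2\<close> forces \<open>2 * p * d / q\<close> colors on them; fewer than
    \<open>p * d / (2 * q)\<close> of these are new in \<open>B1\<close>, so the rest lie in
    \<open>A\<close> or \<open>B\<close>.\<close>
  have "3 * (p * d) \<le> 2 * q * (card A + card B)"
  proof (cases "many_new h")
    case True
    then have "p * d \<le> 2 * q * card B"
      by (simp add: many_new_def B_def group)
    then show ?thesis using cardA by (simp add: algebra_simps)
  next
    case False
    then have few: "2 * q * card (B1 - A) < p * d" by (simp add: many_new_def group)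
    have "2 * (p * d) = card {p * d..<3 * (p * d)}" by simp
    also have "\<dots> \<le> q * card (colors {p * d..<3 * (p * d)})"
    proof (rule card_le_colors[OF h le])
      show "{p * d..<3 * (p * d)} \<subseteq> {..<length h}" using len_ge by auto
      show "2 \<in> pt t" if "t \<in> {p * d..<3 * (p * d)}" for t
        using that points_B1[of t] points_B2[of t] gap_bounds[of "take t h"] False
        by (cases "t < 2 * (p * d)") auto
    qed
    also have "{p * d..<3 * (p * d)} = {p * d..<2 * (p * d)} \<union> {2 * (p * d)..<3 * (p * d)}"
      by auto
    also have "colors \<dots> = B1 \<union> B2" by (simp add: image_Un B1_def B2_def)
    also have "card (B1 \<union> B2) \<le> card (A \<union> (B1 - A) \<union> B)"
      using fin finB False by (intro card_mono) (auto simp: B_def)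
    also have "card (A \<union> (B1 - A) \<union> B) \<le> card A + card (B1 - A) + card B"
      by (meson add_le_mono1 card_Un_le order_trans)
    finally have "2 * (p * d) \<le> q * (card A + card (B1 - A) + card B)" by simp
    then show ?thesis using few by (simp add: algebra_simps)
  qed
  moreover have "(2 * m + p) * d = 3 * (p * d) + 2 * ((m - p) * d)"
  proof -
    have "2 * m + p = 3 * p + 2 * (m - p)" using p_le by simp
    then show ?thesis by (metis add_mult_distrib mult.assoc)
  qed
  moreover have "2 * q * (card A + card B + card C) \<le> 2 * q * card (set (map snd h))"
    using total by (rule mult_left_mono) simp
  ultimately show ?thesis using cardC by (simp add: algebra_simps)
qed

section \<open>The off-line coloring\<close>

text \<open>\<open>A\<close> and \<open>B2\<close> share the slots below \<open>p\<close>, and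
  \<open>C\<close> takes those from \<open>p\<close> on. \<open>B1\<close> joins \<open>A\<close> if
  it succeeds, as \<open>B2\<close> is then far away; otherwise it shares with \<open>C\<close>,
  which then lies to its left.\<close>

definition slot :: "nat \<Rightarrow> nat" where
  "slot s = (if s < p then s else if s < 2 * p then (if many_new h then s - p else s) else s - 2 * p)"

lemma slots_apart:
  assumes "t < length h" "u < length h" "t div d < u div d" "slot (t div d) = slot (u div d)"
  shows "pt t \<inter> pt u = {}"
proof -
  have less: "x div d < i * p \<longleftrightarrow> x < i * (p * d)" for x i
    using d div_less_iff_less_mult[of d x "i * p"] by (simp add: mult.assoc)
  note less1 = less[of _ 1, simplified]
  \<comment> \<open>Stages of one block have distinct slots; the cases are the pairs of blocks that
    can share one.\<close>
  consider "t div d < p" "p \<le> u div d" "u div d < 2 * p"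
    | "t div d < p" "2 * p \<le> u div d" "u div d < 3 * p"
    | "p \<le> t div d" "t div d < 2 * p" "many_new h" "2 * p \<le> u div d" "u div d < 3 * p"
    | "p \<le> t div d" "t div d < 2 * p" "\<not> many_new h" "3 * p \<le> u div d"
    using assms(3,4) by (auto simp: slot_def split: if_splits)
  then show ?thesis
  proof cases
    case 1
    then have "t < p * d" "p * d \<le> u" "u < 2 * (p * d)"
      using less1 less[of _ 2] by (simp_all add: not_less[symmetric])
    then show ?thesis using gap_bounds[of "take u h"] by (auto simp: points_A points_B1)
  next
    case 2
    then have "t < p * d" "2 * (p * d) \<le> u" "u < 3 * (p * d)"
      using less1 less[of _ 2] less[of _ 3] by (simp_all add: not_less[symmetric])
    then show ?thesis using gap_bounds[of "take u h"] by (auto simp: points_A points_B2)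
  next
    case 3
    then have "p * d \<le> t" "t < 2 * (p * d)" "2 * (p * d) \<le> u" "u < 3 * (p * d)"
      using less1 less[of _ 2] less[of _ 3] by (simp_all add: not_less[symmetric])
    then show ?thesis using gap_bounds[of "take t h"] 3 by (auto simp: points_B1 points_B2)
  next
    case 4
    then have "p * d \<le> t" "t < 2 * (p * d)" "3 * (p * d) \<le> u"
      using less1 less[of _ 2] less[of _ 3] by (simp_all add: not_less[symmetric])
    then show ?thesis using gap_bounds[of "take t h"] gap_bounds[of h] 4 assms(2)
      by (auto simp: points_B1 points_C)
  qed
qed

lemma few_colors_suffice: "colorable k d (real m * (real d / real k + 2 * real q)) (map fst h)"
proof (rule colorable_by_slots[OF h _ k])
  show "length h \<le> (m + 2 * p) * d" using len by simp
  show "slot s < m" if "s < m + 2 * p" for s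
    using that p_le by (auto simp: slot_def)
  fix t u assume "t < length h" "u < length h" "t div d \<noteq> u div d" "slot (t div d) = slot (u div d)"
  then show "pt t \<inter> pt u = {}"
    using slots_apart[of t u] slots_apart[of u t] by (cases "t div d < u div d") auto
qed

end

lemma forcing_strategy:
  "\<exists>S. presenter_strategy k d S \<and> (\<forall>h. play k d S h \<longrightarrow> S h = None \<longrightarrow>
     (2 * m + p) * d \<le> 2 * q * card (set (map snd h)) \<and>
     colorable k d (real m * (real d / real k + 2 * real q)) (map fst h))"
proof -
  have "consistent []"
    by (auto simp: consistent_def shaped_def hued_def uses_def kd_coloring_def class_at_def)
  then have "\<exists>S. presenter_strategy k d S \<and> (\<forall>h. play k d S h \<longrightarrow> S h = None \<longrightarrow>
      consistent h \<and> length h = (m + 2 * p) * d)"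
    by (rule play_from_invariant) (rule consistent_step)
  then show ?thesis using many_colors few_colors_suffice by blast
qed

end

section \<open>Conversion to the logarithmic bounds\<close>

theorem theorem4:
  fixes d k m :: nat
  assumes "d \<ge> 2" and "k \<ge> 1" and "m \<ge> 1"
  shows "\<exists>S. presenter_strategy k d S \<and>
    forces k d S
      (real_of_int \<lfloor>5 * real m / 2\<rfloor> * (real d / (log 2 (real d) + 3)))
      (real m * (real d / real k + log 2 (real d) + 3))"
proof -
  obtain q where hues: "q \<ge> 1" "2 * real q \<le> log 2 (real d) + 3" "d \<le> q * ((2 * q) choose q)"
    using hue_count_exists[OF assms(1)] by blast
  interpret unit_game d q k m using assms hues by unfold_locales
  obtain S where S: "presenter_strategy k d S"
    "\<And>h. play k d S h \<Longrightarrow> S h = None \<Longrightarrow> (2 * m + p) * d \<le> 2 * q * card (set (map snd h)) \<and>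
      colorable k d (real m * (real d / real k + 2 * real q)) (map fst h)"
    using forcing_strategy by blast
  \<comment> \<open>Here \<open>2 * m + m div 2\<close> is \<open>5 * m div 2\<close>.\<close>
  have floor: "real_of_int \<lfloor>5 * real m / 2\<rfloor> = real (2 * m + p)"
  proof -
    have "\<lfloor>5 * real m / 2\<rfloor> = int (5 * m div 2)"
      using floor_divide_of_nat_eq[of "5 * m" 2, where 'a = real] by simp
    also have "5 * m div 2 = 2 * m + p" by (simp add: p_def)
    finally show ?thesis by simp
  qed
  have H: "log 2 (real d) + 3 > 0" using assms(1) by (simp add: add_nonneg_pos)
  have "forces k d S (real (2 * m + p) * (real d / (log 2 (real d) + 3)))
      (real m * (real d / real k + log 2 (real d) + 3))"
    unfolding forces_def
  proof (intro allI impI conjI)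
    fix h assume h: "play k d S h" "S h = None"
    have "real ((2 * m + p) * d) \<le> real (2 * q * card (set (map snd h)))"
      using S(2)[OF h] of_nat_le_iff by blast
    also have "\<dots> \<le> (log 2 (real d) + 3) * real (card (set (map snd h)))"
      using hues(2) by (simp add: mult_right_mono)
    finally show "real (2 * m + p) * (real d / (log 2 (real d) + 3)) \<le> real (card (set (map snd h)))"
      using H by (simp add: field_simps)
    have "real m * (real d / real k + 2 * real q) \<le> real m * (real d / real k + log 2 (real d) + 3)"
      using hues(2) by (intro mult_left_mono) auto
    then show "colorable k d (real m * (real d / real k + log 2 (real d) + 3)) (map fst h)"
      using S(2)[OF h] by (auto simp: colorable_def)
  qed
  then show ?thesis using S(1) floor by auto
qed

end
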